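(* Let $(G,\mathbf{w})$ be a connected weighted graph with vertices $v_1,\dots,v_n$ and let $w_{ij}=d_\mathbf{w}(v_i,v_j)$. Then $\beta(G,\mathbf{w}) \geq \frac{\sum_{1\le i<j\le n} w_{ij}}{\lfloor n^2/4\rfloor}$.
   Context: A weighted graph $(G,\mathbf{w})$ is a finite simple graph with positive integer edge weights that is weight-minimal: every edge is a shortest path between its endpoints. $d_\mathbf{w}(u,v)$ is the minimum total weight of a $(u,v)$-path. For a positive integer $\lambda$, $c_\lambda(G,\mathbf{w})$ is the minimum $m$ such that there is $f:V(G)\to\{0,1\}^m$ with $\lambda\, d_\mathbf{w}(u,v)\le d_H(f(u),f(v))$ for all $u,v$ ($d_H$ the Hamming distance). $\beta(G,\mathbf{w}):=\lim_{\lambda\to\infty} c_\lambda(G,\mathbf{w})/\lambda$ (this limit exists by subadditivity). *)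

theory Defs
  imports Complex_Main "HOL-Library.FuncSet" "Graph_Theory.Graph_Theory"
begin

text \<open>
  Following the Graph-Theory library, a finite simple graph is a finite symmetric digraph without
  loops and multiple arcs (locale \<^locale>\<open>graph\<close>): an undirected edge is a pair of opposite arcs,
  so edge weights are arc weights that agree on opposite arcs.

  The distance is only meaningful if some path from \<open>u\<close> to \<open>v\<close> exists. Paths may be empty, hence
  the distance of a vertex from itself is \<open>0\<close>.
\<close>

definition weighted_dist :: "('a, 'b) pre_digraph \<Rightarrow> ('b \<Rightarrow> nat) \<Rightarrow> 'a \<Rightarrow> 'a \<Rightarrow> nat" where
  "weighted_dist G w u v = (LEAST c. \<exists>p. pre_digraph.apath G u p v \<and> c = sum_list (map w p))"

locale weighted_graph = graph G for G :: "('a, 'b) pre_digraph" (structure) +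
  fixes w :: "'b \<Rightarrow> nat"
  assumes weight_sym:
      "\<lbrakk>e \<in> arcs G; e' \<in> arcs G; tail G e' = head G e; head G e' = tail G e\<rbrakk> \<Longrightarrow> w e' = w e"
    and weight_pos: "e \<in> arcs G \<Longrightarrow> 0 < w e"
    and weight_minimal: "e \<in> arcs G \<Longrightarrow> w e = weighted_dist G w (tail G e) (head G e)"

text \<open>Between connected vertices this is the library's distance \<open>\<mu>\<close>.\<close>

lemma (in weighted_graph) weighted_dist_eq_\<mu>:
  assumes "u \<rightarrow>\<^sup>* v"
  shows "\<mu> (\<lambda>e. real (w e)) u v = ereal (real (weighted_dist G w u v))"
proof -
  have cost: "awalk_cost (\<lambda>e. real (w e)) p = real (sum_list (map w p))" for p
    by (induction p) auto
  obtain p where p: "apath u p v" "\<mu> (\<lambda>e. real (w e)) u v = awalk_cost (\<lambda>e. real (w e)) p"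
    using min_cost_awalk[OF assms, of "\<lambda>e. real (w e)"] by auto
  have "weighted_dist G w u v = sum_list (map w p)"
    unfolding weighted_dist_def
  proof (rule Least_equality)
    show "\<exists>q. apath u q v \<and> sum_list (map w p) = sum_list (map w q)"
      using p(1) by blast
  next
    fix c assume "\<exists>q. apath u q v \<and> c = sum_list (map w q)"
    then obtain q where q: "apath u q v" "c = sum_list (map w q)" by blast
    have "\<mu> (\<lambda>e. real (w e)) u v \<le> awalk_cost (\<lambda>e. real (w e)) q"
      by (rule min_cost_le_walk_cost[OF awalkI_apath[OF q(1)]])
    then show "sum_list (map w p) \<le> c"
      unfolding p(2) q(2) cost by simp
  qed
  then show ?thesis unfolding p(2) cost by simp
qed

text \<open>The binary words of length \<open>m\<close> are the elements of \<open>{..<m} \<rightarrow>\<^sub>E {0, 1}\<close>.\<close>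

definition hamming_dist :: "nat \<Rightarrow> (nat \<Rightarrow> nat) \<Rightarrow> (nat \<Rightarrow> nat) \<Rightarrow> nat" where
  "hamming_dist m x y = card {i \<in> {..<m}. x i \<noteq> y i}"

definition min_code_length :: "('a, 'b) pre_digraph \<Rightarrow> ('b \<Rightarrow> nat) \<Rightarrow> nat \<Rightarrow> nat" where
  "min_code_length G w l = (LEAST m. \<exists>f \<in> verts G \<rightarrow> ({..<m} \<rightarrow>\<^sub>E {0, 1}).
     \<forall>u \<in> verts G. \<forall>v \<in> verts G. l * weighted_dist G w u v \<le> hamming_dist m (f u) (f v))"

definition beta :: "('a, 'b) pre_digraph \<Rightarrow> ('b \<Rightarrow> nat) \<Rightarrow> real" where
  "beta G w = lim (\<lambda>l. real (min_code_length G w l) / real l)"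

end

theory Submission
  imports Defs
begin

text \<open>
  Each coordinate of a code for \<open>\<lambda> d\<close> is a cut of the \<open>n\<close> vertices and hence separates at most
  \<open>\<lfloor>n\<^sup>2 / 4\<rfloor>\<close> pairs. Summing the distance requirement over all pairs therefore bounds every
  ratio \<open>c\<^sub>\<lambda> / \<lambda>\<close> from below. As concatenation of codes makes \<open>c\<^sub>\<lambda>\<close> subadditive, the ratios
  converge by Fekete's lemma, and the bound passes to the limit.
\<close>

section \<open>Fekete's lemma\<close>

text \<open>Blocks of length \<open>k\<close> are peeled off one at a time. The remainder stays
  inside \<open>a r\<close>, so the base case says nothing about the sign of
  \<open>a 0\<close>.\<close>

lemma subadditive_mult_add_le:
  fixes a :: "nat \<Rightarrow> real"
  assumes "\<And>m n. a (m + n) \<le> a m + a n"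
  shows "a (q * k + r) \<le> real q * a k + a r"
proof (induction q)
  case (Suc q)
  have "a (Suc q * k + r) \<le> a k + a (q * k + r)"
    using assms[of k "q * k + r"] by (simp add: algebra_simps)
  with Suc show ?case by (simp add: algebra_simps)
qed simp

text \<open>The limit is the infimum of the ratios: none lies below it, and division with remainder
  by an index \<open>k\<close> of nearly minimal ratio forces all late ratios close to that of
  \<open>k\<close>.\<close>

lemma Fekete_convergent:
  fixes a :: "nat \<Rightarrow> real"
  assumes sub: "\<And>m n. a (m + n) \<le> a m + a n"
    and bdd: "bdd_below ((\<lambda>n. a n / real n) ` {1..})"
  shows "convergent (\<lambda>n. a n / real n)"
proof -
  \<comment> \<open>Index 0 is left out because division by zero gives the ratio 0 there, which
    could lie below all genuine ratios.\<close>
  define L where "L = (INF n\<in>{1..}. a n / real n)"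
  have "(\<lambda>n. a n / real n) \<longlonglongrightarrow> L"
  proof (rule order_tendstoI)
    fix b assume "b < L"
    have "L \<le> a n / real n" if "1 \<le> n" for n
      unfolding L_def using that by (intro cINF_lower bdd) auto
    with \<open>b < L\<close> show "\<forall>\<^sub>F n in sequentially. b < a n / real n"
      by (intro eventually_sequentiallyI[of 1]) (metis less_le_trans)
  next
    fix b assume "L < b"
    then obtain k where k: "1 \<le> k" "a k / real k < b"
      unfolding L_def using cINF_less_iff[of "{1::nat..}", OF _ bdd] by auto
    define c where "c = a k / real k"
    \<comment> \<open>There are only finitely many remainders mod \<open>k\<close>, so one constant
      bounds their excess over the line of slope \<open>c\<close>; after division by
      \<open>n\<close> it vanishes.\<close>
    define M where "M = Max ((\<lambda>r. a r - real r * c) ` {..<k})"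
    have upper: "a n \<le> real n * c + M" for n
    proof -
      have "a (n div k * k + n mod k) \<le> real (n div k) * a k + a (n mod k)"
        by (rule subadditive_mult_add_le[OF sub])
      moreover have "real (n div k) * a k = (real n - real (n mod k)) * c"
      proof -
        have "real n - real (n mod k) = real (n div k) * real k"
          by (metis add_diff_cancel_right' div_mult_mod_eq of_nat_add of_nat_mult)
        then show ?thesis using k(1) by (simp add: c_def)
      qed
      moreover have "a (n mod k) - real (n mod k) * c \<le> M"
        unfolding M_def using k(1) by (intro Max_ge) auto
      ultimately show ?thesis by (simp add: algebra_simps)
    qed
    have "(\<lambda>n. c + M / real n) \<longlonglongrightarrow> c + 0"
      by (intro tendsto_intros tendsto_divide_0[OF tendsto_const] filterlim_real_sequentially
          filterlim_at_top_imp_at_infinity)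
    then have "\<forall>\<^sub>F n in sequentially. c + M / real n < b"
      using k(2) by (intro order_tendstoD(2)) (auto simp: c_def)
    then show "\<forall>\<^sub>F n in sequentially. a n / real n < b"
      using eventually_ge_at_top[of 1]
    proof eventually_elim
      case (elim n)
      have "a n / real n \<le> (real n * c + M) / real n"
        by (intro divide_right_mono upper) simp
      also have "\<dots> = c + M / real n"
        using elim(2) by (simp add: field_simps)
      finally show ?case using elim(1) by simp
    qed
  qed
  then show ?thesis by (rule convergentI)
qed

section \<open>Codes\<close>

text \<open>Isolates the condition minimised in \<open>min_code_length\<close>, with length and map
  explicit, so that codes can be built and combined before the \<open>LEAST\<close> is
  taken.\<close>

definition is_code :: "('a, 'b) pre_digraph \<Rightarrow> ('b \<Rightarrow> nat) \<Rightarrow> nat \<Rightarrow> nat \<Rightarrow> ('a \<Rightarrow> nat \<Rightarrow> nat) \<Rightarrow> bool"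
  where "is_code G w l m f \<longleftrightarrow> f \<in> verts G \<rightarrow> ({..<m} \<rightarrow>\<^sub>E {0, 1}) \<and>
     (\<forall>u \<in> verts G. \<forall>v \<in> verts G. l * weighted_dist G w u v \<le> hamming_dist m (f u) (f v))"

lemma min_code_length_eq: "min_code_length G w l = (LEAST m. \<exists>f. is_code G w l m f)"
  unfolding min_code_length_def is_code_def Bex_def ..

lemma is_code_bit:
  assumes "is_code G w l m f" "u \<in> verts G" "i < m"
  shows "f u i \<in> {0, 1}"
proof -
  have "f u \<in> {..<m} \<rightarrow>\<^sub>E {0, 1}"
    using assms unfolding is_code_def by blast
  from PiE_mem[OF this, of i] show ?thesis using assms(3) by simp
qed

lemma (in wf_digraph) weighted_dist_self:
  assumes "u \<in> verts G"
  shows "weighted_dist G w u u = 0"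
  unfolding weighted_dist_def using assms
  by (intro Least_equality) (auto simp: apath_Nil_iff intro!: exI[of _ "[]"])

lemma hamming_dist_append:
  "hamming_dist (m + k) (\<lambda>i\<in>{..<m + k}. if i < m then x i else x' (i - m))
      (\<lambda>i\<in>{..<m + k}. if i < m then y i else y' (i - m))
    = hamming_dist m x y + hamming_dist k x' y'" (is "hamming_dist _ ?X ?Y = _")
proof -
  have "{i \<in> {..<m + k}. ?X i \<noteq> ?Y i} =
      {i \<in> {..<m}. x i \<noteq> y i} \<union> (+) m ` {i \<in> {..<k}. x' i \<noteq> y' i}" (is "?L = ?A \<union> ?B")
  proof (intro equalityI subsetI)
    fix i assume "i \<in> ?L"
    then show "i \<in> ?A \<union> ?B"
      by (cases "i < m") (auto intro!: image_eqI[of _ _ "i - m"])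
  qed auto
  moreover have "card (?A \<union> ?B) = card ?A + card ?B"
    by (intro card_Un_disjoint) auto
  moreover have "card ?B = card {i \<in> {..<k}. x' i \<noteq> y' i}"
    by (intro card_image) simp
  ultimately show ?thesis by (simp add: hamming_dist_def)
qed

text \<open>Under concatenation Hamming distances add, and so do the required multiples of the
  distance. This is the source of subadditivity.\<close>

lemma is_code_append:
  assumes f: "is_code G w l m f" and g: "is_code G w l' k g"
  shows "is_code G w (l + l') (m + k)
    (\<lambda>u. \<lambda>i\<in>{..<m + k}. if i < m then f u i else g u (i - m))"
  unfolding is_code_def hamming_dist_append
proof (intro conjI ballI Pi_I PiE_I)
  fix u i assume u: "u \<in> verts G" and i: "i \<in> {..<m + k}"
  have "f u i \<in> {0, 1}" if "i < m"
    using is_code_bit[OF f u that] .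
  moreover have "g u (i - m) \<in> {0, 1}" if "\<not> i < m"
    using i that by (intro is_code_bit[OF g u]) auto
  ultimately show "(\<lambda>i\<in>{..<m + k}. if i < m then f u i else g u (i - m)) i \<in> {0, 1}"
    using i by simp
next
  fix u v assume "u \<in> verts G" "v \<in> verts G"
  then show "(l + l') * weighted_dist G w u v \<le> hamming_dist m (f u) (f v) + hamming_dist k (g u) (g v)"
    using f g by (auto simp: is_code_def add_mult_distrib intro: add_mono)
qed auto

text \<open>Guarantees that the \<open>LEAST\<close> in \<open>min_code_length\<close> is attained.
  The code gives each vertex its own unit word and repeats it often enough to exceed every required
  distance.\<close>

lemma (in fin_digraph) is_code_exists: "\<exists>m f. is_code G w l m f"
proof -
  obtain e :: "'a \<Rightarrow> nat" where e: "inj_on e (verts G)"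
    using finite_imp_inj_to_nat_seg[OF finite_verts] by metis
  define N where "N = Suc (Max (e ` verts G))"
  have eN: "e u < N" if "u \<in> verts G" for u
    unfolding N_def using that by (simp add: less_Suc_eq_le)
  \<comment> \<open>A crude common bound for all distances; unlike a maximum, the sum is also
    meaningful for an empty vertex set.\<close>
  define D where "D = (\<Sum>u\<in>verts G. \<Sum>v\<in>verts G. weighted_dist G w u v)"
  have D: "weighted_dist G w u v \<le> D" if "u \<in> verts G" "v \<in> verts G" for u v
  proof -
    have "weighted_dist G w u v \<le> (\<Sum>v\<in>verts G. weighted_dist G w u v)"
      using that by (intro member_le_sum) auto
    also have "\<dots> \<le> D"
      unfolding D_def using that by (intro member_le_sum[of u]) auto
    finally show ?thesis .
  qed
  define B where "B = l * D"
  \<comment> \<open>The word consists of \<open>B\<close> blocks of \<open>N\<close> bits, and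
    \<open>u\<close> sets exactly the bit \<open>e u\<close> of each block.\<close>
  define f where "f u = (\<lambda>i\<in>{..<B * N}. if i mod N = e u then 1 else 0 :: nat)" for u
  have "is_code G w l (B * N) f"
    unfolding is_code_def
  proof (intro conjI ballI Pi_I)
    show "f u \<in> {..<B * N} \<rightarrow>\<^sub>E {0, 1}" for u
      by (auto simp: f_def)
  next
    fix u v assume uv: "u \<in> verts G" "v \<in> verts G"
    show "l * weighted_dist G w u v \<le> hamming_dist (B * N) (f u) (f v)"
    proof (cases "u = v")
      case True
      then show ?thesis using weighted_dist_self[OF uv(1)] by simp
    next
      case False
      then have neq: "e u \<noteq> e v" using e uv by (auto dest: inj_onD)
      \<comment> \<open>In each block the bit belonging to \<open>u\<close> already separates
        \<open>u\<close> from \<open>v\<close>, which yields \<open>B\<close> differing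
        positions.\<close>
      have "(\<lambda>b. b * N + e u) ` {..<B} \<subseteq> {i \<in> {..<B * N}. f u i \<noteq> f v i}"
      proof (intro subsetI, elim imageE)
        fix i b assume b: "i = b * N + e u" "b \<in> {..<B}"
        have "i < Suc b * N" using eN[OF uv(1)] b by simp
        also have "\<dots> \<le> B * N" using b by (intro mult_le_mono1) auto
        finally have "i < B * N" .
        moreover have "i mod N = e u" using b eN[OF uv(1)] by simp
        ultimately show "i \<in> {i \<in> {..<B * N}. f u i \<noteq> f v i}"
          using neq by (auto simp: f_def)
      qed
      then have "card ((\<lambda>b. b * N + e u) ` {..<B}) \<le> hamming_dist (B * N) (f u) (f v)"
        unfolding hamming_dist_def by (intro card_mono) auto
      moreover have "card ((\<lambda>b. b * N + e u) ` {..<B}) = B"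
        using eN[OF uv(1)] by (subst card_image) (auto simp: inj_on_def)
      ultimately show ?thesis
        using mult_le_mono2[OF D[OF uv], of l] unfolding B_def by linarith
    qed
  qed
  then show ?thesis by blast
qed

lemma (in fin_digraph) min_code_length_code: "\<exists>f. is_code G w l (min_code_length G w l) f"
  unfolding min_code_length_eq using is_code_exists by (rule LeastI_ex)

lemma (in fin_digraph) min_code_length_subadditive:
  "min_code_length G w (l + l') \<le> min_code_length G w l + min_code_length G w l'"
proof -
  obtain f g where "is_code G w l (min_code_length G w l) f" "is_code G w l' (min_code_length G w l') g"
    using min_code_length_code by blast
  then have "\<exists>h. is_code G w (l + l') (min_code_length G w l + min_code_length G w l') h"
    by (blast intro: is_code_append)
  then show ?thesis
    unfolding min_code_length_eq[of _ _ "l + l'"] by (rule Least_le)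
qed

text \<open>Needed because \<open>beta\<close> is defined by \<open>lim\<close>, which is
  informative only for convergent sequences. The ratios are bounded below by 0.\<close>

lemma (in fin_digraph) min_code_length_convergent:
  "convergent (\<lambda>l. real (min_code_length G w l) / real l)"
proof (rule Fekete_convergent)
  show "real (min_code_length G w (m + k)) \<le> real (min_code_length G w m) + real (min_code_length G w k)"
    for m k
    using min_code_length_subadditive[of w m k] by linarith
  show "bdd_below ((\<lambda>l. real (min_code_length G w l) / real l) ` {1..})"
    by (rule bdd_belowI2[of _ 0]) simp
qed

section \<open>Counting separated pairs\<close>

text \<open>A 0-1 labelling splits the indices into classes of sizes \<open>a\<close> and
  \<open>b\<close> with \<open>a + b = n\<close>. It separates at most \<open>a * b\<close> pairs,
  and \<open>4 * a * b\<close> is at most the square of \<open>a + b\<close>.\<close>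

lemma card_separated_pairs_le:
  fixes x :: "nat \<Rightarrow> nat"
  assumes "\<And>i. i \<in> {1..n} \<Longrightarrow> x i \<in> {0, 1}"
  shows "card {(i, j). 1 \<le> i \<and> i < j \<and> j \<le> n \<and> x i \<noteq> x j} \<le> n\<^sup>2 div 4"
proof -
  define A where "A = {i \<in> {1..n}. x i = 0}"
  define B where "B = {i \<in> {1..n}. x i = 1}"
  define P where "P = {(i, j). 1 \<le> i \<and> i < j \<and> j \<le> n \<and> x i \<noteq> x j}"
  have 01: "x i = 0 \<or> x i = 1" if "1 \<le> i" "i \<le> n" for i
    using assms[of i] that by auto
  have "card P \<le> card (A \<times> B)"
  proof (rule card_inj_on_le)
    \<comment> \<open>Turns each pair so that its end labelled 0 comes first. The turn is injective
      because \<open>i < j\<close> recovers the original order.\<close>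
    let ?h = "\<lambda>(i, j). if x i = 0 then (i, j) else (j, i)"
    show "inj_on ?h P"
      by (auto simp: inj_on_def P_def split: if_splits)
    show "?h ` P \<subseteq> A \<times> B"
    proof (intro subsetI, elim imageE)
      fix p q assume "p = ?h q" "q \<in> P"
      then obtain i j where "q = (i, j)" "1 \<le> i" "i < j" "j \<le> n" "x i \<noteq> x j"
        by (auto simp: P_def)
      with \<open>p = ?h q\<close> 01[of i] 01[of j] show "p \<in> A \<times> B"
        by (auto simp: A_def B_def)
    qed
  qed (simp add: A_def B_def)
  moreover have "card A + card B = n"
  proof -
    have "A \<union> B = {1..n}" using assms by (fastforce simp: A_def B_def)
    moreover have "card (A \<union> B) = card A + card B"
      by (intro card_Un_disjoint) (auto simp: A_def B_def)
    ultimately show ?thesis by simp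
  qed
  moreover have "4 * (a * b) \<le> (a + b)\<^sup>2" for a b :: nat
  proof -
    \<comment> \<open>The difference is formed over the integers, as subtraction of naturals
      truncates.\<close>
    have "0 \<le> (int a - int b)\<^sup>2" by simp
    then have "int (4 * (a * b)) \<le> int ((a + b)\<^sup>2)"
      by (simp add: power2_eq_square algebra_simps)
    then show ?thesis by linarith
  qed
  ultimately have "4 * card P \<le> n\<^sup>2"
    by (metis card_cartesian_product le_trans mult_le_mono2)
  then show ?thesis by (simp add: P_def)
qed

text \<open>Double counting of the triples of two vertices and a coordinate separating them: each
  pair contributes at least \<open>l\<close> times its distance, each coordinate at most
  \<open>n\<^sup>2 div 4\<close>.\<close>

lemma code_length_lower_bound:
  assumes code: "is_code G w l m f" and v: "v ` {1..n} \<subseteq> verts G"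
  shows "l * (\<Sum>(i, j) \<in> {(i, j). 1 \<le> i \<and> i < j \<and> j \<le> n}. weighted_dist G w (v i) (v j))
    \<le> m * (n\<^sup>2 div 4)"
proof -
  define P where "P = {(i, j). 1 \<le> i \<and> i < j \<and> j \<le> n}"
  have "P \<subseteq> {1..n} \<times> {1..n}" by (auto simp: P_def)
  then have finP: "finite P" by (rule finite_subset) simp
  have "l * (\<Sum>(i, j) \<in> P. weighted_dist G w (v i) (v j))
      \<le> (\<Sum>(i, j) \<in> P. hamming_dist m (f (v i)) (f (v j)))"
    unfolding sum_distrib_left
  proof (intro sum_mono, clarify)
    fix i j assume "(i, j) \<in> P"
    then have "v i \<in> verts G" "v j \<in> verts G" using v by (auto simp: P_def)
    then show "l * weighted_dist G w (v i) (v j) \<le> hamming_dist m (f (v i)) (f (v j))"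
      using code by (auto simp: is_code_def)
  qed
  also have "\<dots> = (\<Sum>p \<in> P. \<Sum>k<m. if f (v (fst p)) k \<noteq> f (v (snd p)) k then 1 else 0)"
    by (intro sum.cong) (auto simp: hamming_dist_def sum.If_cases Int_def)
  \<comment> \<open>Exchanging the sums passes from counting by pairs to counting by coordinates,
    each of which is a cut.\<close>
  also have "\<dots> = (\<Sum>k<m. \<Sum>p \<in> P. if f (v (fst p)) k \<noteq> f (v (snd p)) k then 1 else 0)"
    by (rule sum.swap)
  also have "\<dots> \<le> (\<Sum>k<m. n\<^sup>2 div 4)"
  proof (rule sum_mono)
    fix k assume k: "k \<in> {..<m}"
    have "f (v i) k \<in> {0, 1}" if "i \<in> {1..n}" for i
      using v k that by (intro is_code_bit[OF code]) auto
    then have "card {(i, j). 1 \<le> i \<and> i < j \<and> j \<le> n \<and> f (v i) k \<noteq> f (v j) k} \<le> n\<^sup>2 div 4"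
      by (rule card_separated_pairs_le)
    moreover have "{(i, j). 1 \<le> i \<and> i < j \<and> j \<le> n \<and> f (v i) k \<noteq> f (v j) k}
        = P \<inter> {p. f (v (fst p)) k \<noteq> f (v (snd p)) k}"
      by (auto simp: P_def)
    ultimately show "(\<Sum>p \<in> P. if f (v (fst p)) k \<noteq> f (v (snd p)) k then 1 else 0) \<le> n\<^sup>2 div 4"
      using finP by (simp add: sum.If_cases)
  qed
  finally show ?thesis by (simp add: P_def)
qed

theorem theorem5:
  fixes G :: "('a, 'b) pre_digraph" and w :: "'b \<Rightarrow> nat" and v :: "nat \<Rightarrow> 'a" and n :: nat
  assumes "weighted_graph G w"
    and "Digraph_Component.connected G"
    and "bij_betw v {1..n} (verts G)"
  shows "beta G w \<ge>
    (\<Sum>(i, j) \<in> {(i, j). 1 \<le> i \<and> i < j \<and> j \<le> n}. real (weighted_dist G w (v i) (v j)))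
      / real_of_int \<lfloor>(real n)\<^sup>2 / 4\<rfloor>"
proof -
  interpret weighted_graph G w by (rule assms(1))
  define S where "S = (\<Sum>(i, j) \<in> {(i, j). 1 \<le> i \<and> i < j \<and> j \<le> n}. weighted_dist G w (v i) (v j))"
  have "\<lfloor>(real n)\<^sup>2 / 4\<rfloor> = int (n\<^sup>2 div 4)"
    using floor_divide_of_nat_eq[of "n\<^sup>2" 4, where 'a = real] by simp
  then have q: "real_of_int \<lfloor>(real n)\<^sup>2 / 4\<rfloor> = real (n\<^sup>2 div 4)"
    by simp
  have bound: "real S / real (n\<^sup>2 div 4) \<le> real (min_code_length G w l) / real l" if "1 \<le> l" for l
  \<comment> \<open>The denominator vanishes exactly for \<open>n\<close> at most 1; the left-hand
    side is then 0 by the convention for division, and the bound is trivial.\<close>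
  proof (cases "n\<^sup>2 div 4 = 0")
    case False
    obtain f where "is_code G w l (min_code_length G w l) f"
      using min_code_length_code by blast
    then have "l * S \<le> min_code_length G w l * (n\<^sup>2 div 4)"
      unfolding S_def using assms(3) by (intro code_length_lower_bound) (auto simp: bij_betw_def)
    then have "real S * real l \<le> real (min_code_length G w l) * real (n\<^sup>2 div 4)"
      unfolding of_nat_mult[symmetric] of_nat_le_iff by (simp only: mult.commute)
    then show ?thesis
      using that False by (simp only: pos_divide_le_eq pos_le_divide_eq times_divide_eq_left of_nat_0_less_iff
          bot_nat_0.not_eq_extremum)
  qed simp
  have "(\<lambda>l. real (min_code_length G w l) / real l) \<longlonglongrightarrow> beta G w"
    unfolding beta_def using min_code_length_convergent by (simp add: convergent_LIMSEQ_iff)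
  \<comment> \<open>The bound holds for every \<open>l\<close> from 1 on, so it survives in the
    limit.\<close>
  then have "real S / real (n\<^sup>2 div 4) \<le> beta G w"
    by (rule LIMSEQ_le_const) (use bound in blast)
  then show ?thesis
    unfolding q S_def by (simp add: case_prod_unfold)
qed

end
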